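(* Let $k\ge2$ and let $B=(1,b_2,\dots,b_k)$ be positive integers with $1<b_2<\cdots<b_k$ forming an orderly sequence; let $c=\max\{O_B(r)\mid 0\le r\le b_k-1\}$ and suppose $c\ge2$. Let $h,d$ be positive integers with $h\ge\left\lceil\frac{d}{c-1}\right\rceil$, and for positive integers $a$ with $\gcd(a,d)=1$ let $A(a)=(a,ha+d,ha+db_2,\dots,ha+db_k)$. Then there exist two sequences of nonnegative integers $W_B=(w_j)_{0\le j\le b_k-1}$ and $R_B=(r_j)_{0\le j\le b_k-1}$ such that for all $a\ge(c-1)b_k$ with $\gcd(a,d)=1$, $$g(A(a))=(w_jh-1)a+r_jd+(ha+b_kd)\left(\left\lfloor\frac{a}{b_k}\right\rfloor-c+1\right),\quad\text{where } a\equiv j\pmod{b_k}.$$ Moreover, $W_B$ and $R_B$ are both (weakly) increasing in $j$, and $w_{b_k-1}-w_0\le1$.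
   Context: For $M\in\mathbb{N}$, $O_B(M):=\min\{\sum_{i=1}^k x_i \mid \sum_{i=1}^k b_ix_i=M,\ x_i\in\mathbb{N}\}$ with $b_1=1$. Let $G_B(M)$ be the number of parts used by the greedy strategy (use as many copies of $b_k$ as possible, then of $b_{k-1}$, and so on). $B$ is orderly if $O_B(M)=G_B(M)$ for all $M\in\mathbb{N}$. The Frobenius number $g(a_1,\dots,a_n)$ of positive integers with $\gcd=1$ is the largest integer not representable as $\sum x_ia_i$ with $x_i\in\mathbb{N}$. *)

theory Defs
  imports Complex_Main "HOL-Number_Theory.Cong"
begin

text \<open>A sequence \<open>B = (b\<^sub>1, \<dots>, b\<^sub>k)\<close> is a list in increasing order, so \<open>b\<^sub>i = B ! (i - 1)\<close> and
  \<open>b\<^sub>k = last B\<close>. Coefficient vectors \<open>x\<close> are functions of which only the values below the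
  length of the list matter.\<close>

definition opt_parts :: "nat list \<Rightarrow> nat \<Rightarrow> nat" where
  "opt_parts B M =
     (LEAST n. \<exists>x :: nat \<Rightarrow> nat. (\<Sum>i<length B. B ! i * x i) = M \<and> n = (\<Sum>i<length B. x i))"

fun greedy_desc :: "nat list \<Rightarrow> nat \<Rightarrow> nat" where
  "greedy_desc [] M = 0"
| "greedy_desc (b # bs) M = M div b + greedy_desc bs (M mod b)"

definition greedy_parts :: "nat list \<Rightarrow> nat \<Rightarrow> nat" where
  "greedy_parts B M = greedy_desc (rev B) M"

definition orderly :: "nat list \<Rightarrow> bool" where
  "orderly B \<longleftrightarrow> (\<forall>M. opt_parts B M = greedy_parts B M)"

definition representable :: "nat list \<Rightarrow> int \<Rightarrow> bool" where
  "representable A n \<longleftrightarrow> (\<exists>x :: nat \<Rightarrow> nat. n = int (\<Sum>i<length A. x i * A ! i))"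

text \<open>The greatest element is taken over the integers, so the value is \<open>-1\<close> when every natural
  number is representable. It is only meaningful for positive entries with gcd 1.\<close>

definition frobenius_number :: "nat list \<Rightarrow> int" where
  "frobenius_number A = (GREATEST n. \<not> representable A n)"

text \<open>\<open>(a, ha + db\<^sub>1, \<dots>, ha + db\<^sub>k)\<close>; the entry \<open>ha + d\<close> is the one for \<open>b\<^sub>1 = 1\<close>.\<close>

definition shifted_seq :: "nat list \<Rightarrow> nat \<Rightarrow> nat \<Rightarrow> nat \<Rightarrow> nat list" where
  "shifted_seq B h d a = a # map (\<lambda>b. h * a + d * b) B"

end

theory Submission
  imports Defs
begin

text \<open>Write \<open>O\<close> for \<^const>\<open>opt_parts\<close> and \<open>L\<close> for the last term \<open>b\<^sub>k\<close>. Since \<open>d\<close> is invertible modulo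
  \<open>a\<close>, the residue classes modulo \<open>a\<close> are those of \<open>d r\<close> with \<open>0 \<le> r < a\<close>, and an element of the
  semigroup in this class has the form \<open>x a + h a n + d M\<close> with \<open>M \<equiv> r\<close> modulo \<open>a\<close> and \<open>n \<ge> O(M)\<close>.
  For \<open>a \<ge> (c - 1) L\<close>, orderliness gives \<open>O(a + r) \<ge> O(r)\<close>, so the least one is \<open>h a O(r) + d r\<close>,
  and the Frobenius number is the maximum of these values over \<open>r < a\<close>, minus \<open>a\<close>.

  The condition on \<open>h\<close> gives \<open>d L \<le> h a\<close>, so that the maximum is attained at the \<open>r < a\<close> which is
  lexicographically maximal for \<open>(O(r), r)\<close>: a competitor \<open>r' > r\<close> has \<open>O(r') < O(r)\<close>, and
  \<open>r' \<le> r + L\<close> because \<open>O(r + L) = O(r) + 1\<close>. Replacing \<open>a\<close> by \<open>a + L\<close> shifts this maximiser by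
  \<open>L\<close>, so it is determined by its value for \<open>(c - 1) L + j\<close>.\<close>

section \<open>Lexicographic maximisers\<close>

text \<open>Ties go to the larger argument, so a competitor above the maximiser has a strictly
  smaller value.\<close>

definition lex_argmax :: "(nat \<Rightarrow> nat) \<Rightarrow> nat \<Rightarrow> nat \<Rightarrow> bool" where
  "lex_argmax f N r \<longleftrightarrow> r < N \<and> (\<forall>s<N. f s \<le> f r \<and> (f s = f r \<longrightarrow> s \<le> r))"

lemma lex_argmax_exists:
  assumes "N > 0"
  shows "\<exists>r. lex_argmax f N r"
proof -
  define w where "w = Max (f ` {..<N})"
  define S where "S = {s. s < N \<and> f s = w}"
  have "w \<in> f ` {..<N}"
    unfolding w_def using assms by (intro Max_in) auto
  then have ne: "S \<noteq> {}" by (auto simp: S_def)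
  have fin: "finite S" by (simp add: S_def)
  have "Max S \<in> S" using fin ne by (rule Max_in)
  moreover have "f s \<le> w" if "s < N" for s
    unfolding w_def using that by (intro Max_ge) auto
  moreover have "s \<le> Max S" if "s < N" "f s = w" for s
    using that fin by (intro Max_ge) (auto simp: S_def)
  ultimately have "lex_argmax f N (Max S)"
    unfolding lex_argmax_def by (auto simp: S_def)
  then show ?thesis ..
qed

text \<open>Source of the monotonicity of both sequences. The old maximiser still competes in the
  larger range, and a new one below it would tie with it and lose the tie.\<close>

lemma lex_argmax_mono:
  assumes "lex_argmax f N r" "lex_argmax f N' r'" "N \<le> N'"
  shows "r \<le> r'" "f r \<le> f r'"
proof -
  have rN: "r < N" "r < N'" using assms by (auto simp: lex_argmax_def)
  show le: "f r \<le> f r'" using assms rN by (auto simp: lex_argmax_def)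
  show "r \<le> r'"
  proof (rule ccontr)
    assume "\<not> r \<le> r'"
    then have "r' < N" using rN by simp
    then have "f r' \<le> f r" using assms(1) by (auto simp: lex_argmax_def)
    then have "f r = f r'" using le by simp
    then show False using assms(2) rN \<open>\<not> r \<le> r'\<close> by (auto simp: lex_argmax_def)
  qed
qed

section \<open>Optimal and greedy part counts\<close>

lemma opt_parts_le:
  "opt_parts B (\<Sum>i<length B. B ! i * x i) \<le> (\<Sum>i<length B. x i)"
  unfolding opt_parts_def by (rule Least_le) blast

lemma opt_parts_attained:
  assumes "B \<noteq> []" "hd B = 1"
  obtains x :: "nat \<Rightarrow> nat"
  where "(\<Sum>i<length B. B ! i * x i) = M" "(\<Sum>i<length B. x i) = opt_parts B M"
proof -
  let ?P = "\<lambda>n. \<exists>x :: nat \<Rightarrow> nat. (\<Sum>i<length B. B ! i * x i) = M \<and> n = (\<Sum>i<length B. x i)"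
  obtain l where l: "length B = Suc l" using assms(1) by (cases B) auto
  have "B ! 0 = 1" using assms by (simp add: hd_conv_nth)
  then have "(\<Sum>i<length B. B ! i * (if i = 0 then M else 0)) = M"
    unfolding l sum.lessThan_Suc_shift by simp
  then have "?P (\<Sum>i<length B. if i = 0 then M else 0)"
    by (intro exI[of _ "\<lambda>i. if i = 0 then M else 0"] conjI refl)
  then have "?P (LEAST n. ?P n)" by (rule LeastI)
  then show thesis using that unfolding opt_parts_def by metis
qed

lemma opt_parts_pos:
  assumes "B \<noteq> []" "hd B = 1" "M > 0"
  shows "opt_parts B M > 0"
proof (rule ccontr)
  assume "\<not> opt_parts B M > 0"
  moreover obtain x :: "nat \<Rightarrow> nat"
    where "(\<Sum>i<length B. B ! i * x i) = M" "(\<Sum>i<length B. x i) = opt_parts B M"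
    by (rule opt_parts_attained[OF assms(1,2)])
  ultimately show False using assms(3) by auto
qed

text \<open>Orderliness transfers this recursion to \<open>opt_parts\<close> and enters the theorem
  in this form.\<close>

lemma greedy_parts_div_mod:
  assumes "B \<noteq> []" "last B > 0"
  shows "greedy_parts B M = M div last B + greedy_parts B (M mod last B)"
proof -
  have "rev B = last B # rev (butlast B)"
    using assms(1) by (metis append_butlast_last_id rev_eq_Cons_iff rev_rev_ident)
  then have "greedy_parts B n = n div last B + greedy_desc (rev (butlast B)) (n mod last B)" for n
    unfolding greedy_parts_def by (metis greedy_desc.simps(2))
  then show ?thesis using assms(2) by simp
qed

section \<open>Functions gaining one per step of length \<open>L\<close>\<close>

text \<open>Adding \<open>a\<close> raises the quotient by at least \<open>c - 1\<close>, while the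
  old remainder contributes at most \<open>c\<close>. If a unit is missing, it comes from a nonzero
  new remainder or from a further unit of the quotient.\<close>

lemma le_add_mult_of_div_mod:
  fixes a L c :: nat
  assumes f: "\<And>M. f M = M div L + f (M mod L)" and "L > 0"
    and c: "\<And>t. t < L \<Longrightarrow> f t \<le> c" and pos: "\<And>t. t > 0 \<Longrightarrow> f t > (0::nat)"
    and a: "a \<ge> (c - 1) * L"
  shows "f r \<le> f (m * a + r)"
proof (induction m)
  case 0
  show ?case by simp
next
  case (Suc m)
  have step: "f s \<le> f (a + s)" for s
  proof -
    have fs: "f s \<le> s div L + c" using f[of s] c[of "s mod L"] \<open>L > 0\<close> by simp
    have "(s div L + (c - 1)) * L \<le> a + s"
      unfolding add_mult_distrib using a div_mult_mod_eq[of s L] by linarith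
    then have q: "s div L + (c - 1) \<le> (a + s) div L"
      using \<open>L > 0\<close> by (simp add: less_eq_div_iff_mult_less_eq)
    show ?thesis
    proof (cases "(a + s) mod L = 0")
      case False
      then show ?thesis using pos[of "(a + s) mod L"] f[of "a + s"] fs q by linarith
    next
      case True
      show ?thesis
      proof (cases "s mod L = 0")
        case True
        then show ?thesis
          using f[of s] f[of "a + s"] \<open>(a + s) mod L = 0\<close> by (simp add: div_le_mono)
      next
        case False
        \<comment> \<open>With equality, the multiple \<open>a + s\<close> of \<open>L\<close> would
          leave no room for the nonzero remainder of \<open>s\<close>.\<close>
        have "s div L + (c - 1) < (a + s) div L"
        proof (rule ccontr)
          assume "\<not> ?thesis"
          then have "(a + s) div L = s div L + (c - 1)" using q by simp
          then have "a + s = (s div L + (c - 1)) * L"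
            using True by (metis add.right_neutral div_mult_mod_eq)
          then have "a + s = s div L * L + (c - 1) * L" by (simp add: add_mult_distrib)
          then have "s \<le> s div L * L" using a by linarith
          then show False using False div_mult_mod_eq[of s L] by linarith
        qed
        then show ?thesis using fs f[of "a + s"] by linarith
      qed
    qed
  qed
  show ?case using Suc step[of "m * a + r"] by (simp add: add.assoc)
qed

text \<open>Translation by \<open>L\<close> raises every value by one and keeps the order among the
  translated competitors. The new points \<open>s < L\<close> lose, since their values are at most
  \<open>f t0\<close> and \<open>t0\<close> already competed because
  \<open>L \<le> N\<close>.\<close>

lemma lex_argmax_shift:
  assumes f: "\<And>M. f (M + L) = Suc (f M)" and c: "\<And>t. t < L \<Longrightarrow> f t \<le> f t0" and "t0 < L" "L \<le> N"
    and r: "lex_argmax f N r"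
  shows "lex_argmax f (N + n * L) (r + n * L)"
proof (induction n)
  case 0
  show ?case using r by simp
next
  case (Suc n)
  define N' r' where "N' = N + n * L" and "r' = r + n * L"
  have r': "lex_argmax f N' r'" using Suc by (simp add: N'_def r'_def)
  have t0: "f t0 \<le> f r'" using r' assms(3,4) by (auto simp: lex_argmax_def N'_def)
  have "f s \<le> f (r' + L) \<and> (f s = f (r' + L) \<longrightarrow> s \<le> r' + L)" if "s < N' + L" for s
  proof (cases "s < L")
    case True
    then show ?thesis using c[of s] t0 f[of r'] by linarith
  next
    case False
    then have "f s = Suc (f (s - L))" "s - L < N'" using f[of "s - L"] that by auto
    then show ?thesis using r' f[of r'] False by (auto simp: lex_argmax_def)
  qed
  then have "lex_argmax f (N' + L) (r' + L)" using r' by (auto simp: lex_argmax_def)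
  then show ?case by (simp add: N'_def r'_def ac_simps)
qed

text \<open>A competitor above \<open>r\<close> loses at least one unit of \<open>f\<close>, which
  costs \<open>h * a\<close>, and gains at most \<open>d * L\<close>.\<close>

lemma lex_argmax_weighted:
  fixes h a d L :: nat
  assumes f: "\<And>M. f (M + L) = Suc (f M)" and r: "lex_argmax f a r" and "s < a"
    and dL: "d * L \<le> h * a"
  shows "h * a * f s + d * s \<le> h * a * f r + d * r"
proof (cases "s \<le> r")
  case True
  then show ?thesis using r \<open>s < a\<close> by (auto simp: lex_argmax_def intro!: add_mono mult_left_mono)
next
  case False
  then have fs: "f s < f r" using r \<open>s < a\<close> by (auto simp: lex_argmax_def le_less)
  have "s \<le> r + L"
  proof (rule ccontr)
    assume "\<not> s \<le> r + L"
    then have "f (r + L) \<le> f r" using r \<open>s < a\<close> by (auto simp: lex_argmax_def)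
    then show False using f[of r] by simp
  qed
  then have "h * a * f s + d * s \<le> h * a * f s + (d * r + d * L)"
    by (metis add_left_mono add_mult_distrib2 mult_le_mono2)
  also have "\<dots> \<le> h * a * Suc (f s) + d * r" using dL by simp
  also have "\<dots> \<le> h * a * f r + d * r" using fs by (intro add_right_mono mult_left_mono) auto
  finally show ?thesis .
qed

section \<open>The semigroup generated by the shifted sequence\<close>

lemma representable_shifted_seq:
  "representable (shifted_seq B h d a) n \<longleftrightarrow>
     (\<exists>x0 (x :: nat \<Rightarrow> nat). n = int (x0 * a + h * a * (\<Sum>i<length B. x i)
        + d * (\<Sum>i<length B. B ! i * x i)))" (is "_ \<longleftrightarrow> ?R")
proof -
  have eq: "(\<Sum>i<length (shifted_seq B h d a). y i * shifted_seq B h d a ! i)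
      = y 0 * a + h * a * (\<Sum>i<length B. y (Suc i)) + d * (\<Sum>i<length B. B ! i * y (Suc i))"
    for y :: "nat \<Rightarrow> nat"
  proof -
    have "(\<Sum>i<length (shifted_seq B h d a). y i * shifted_seq B h d a ! i)
      = y 0 * a + (\<Sum>i<length B. y (Suc i) * (h * a + d * B ! i))"
      by (simp add: shifted_seq_def sum.lessThan_Suc_shift del: sum.lessThan_Suc)
    also have "(\<Sum>i<length B. y (Suc i) * (h * a + d * B ! i))
      = h * a * (\<Sum>i<length B. y (Suc i)) + d * (\<Sum>i<length B. B ! i * y (Suc i))"
      by (simp add: sum_distrib_left sum.distrib[symmetric] algebra_simps)
    finally show ?thesis by simp
  qed
  show ?thesis
  proof
    assume "representable (shifted_seq B h d a) n"
    then show ?R unfolding representable_def eq by blast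
  next
    assume ?R
    then obtain x0 and x :: "nat \<Rightarrow> nat" where
      "n = int (x0 * a + h * a * (\<Sum>i<length B. x i) + d * (\<Sum>i<length B. B ! i * x i))"
      by blast
    then show "representable (shifted_seq B h d a) n"
      unfolding representable_def eq by (intro exI[of _ "case_nat x0 x"]) simp
  qed
qed

text \<open>The Brauer-Shockley principle: the largest among the least elements of the residue
  classes modulo \<open>a\<close>, minus \<open>a\<close>. Minimality comes from \<open>ge\<close>,
  and \<open>max\<close> selects the class of \<open>r\<close>.\<close>

lemma frobenius_number_shifted_seq:
  fixes a d h r :: nat
  assumes "B \<noteq> []" "hd B = 1" "a > 0" "coprime a d"
    and ge: "\<And>m s. s < a \<Longrightarrow> opt_parts B s \<le> opt_parts B (m * a + s)"
    and "r < a"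
    and max: "\<And>s. s < a \<Longrightarrow> h * a * opt_parts B s + d * s \<le> h * a * opt_parts B r + d * r"
  shows "frobenius_number (shifted_seq B h d a) = int (h * a * opt_parts B r + d * r) - int a"
  unfolding frobenius_number_def
proof (rule Greatest_equality)
  show "\<not> representable (shifted_seq B h d a) (int (h * a * opt_parts B r + d * r) - int a)"
  proof
    assume "representable (shifted_seq B h d a) (int (h * a * opt_parts B r + d * r) - int a)"
    then obtain x0 and x :: "nat \<Rightarrow> nat" where
      x: "int (h * a * opt_parts B r + d * r) - int a = int (x0 * a + h * a * (\<Sum>i<length B. x i)
        + d * (\<Sum>i<length B. B ! i * x i))"
      unfolding representable_shifted_seq by blast
    define M where "M = (\<Sum>i<length B. B ! i * x i)"
    define n where "n = (\<Sum>i<length B. x i)"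
    have n: "opt_parts B M \<le> n" unfolding M_def n_def by (rule opt_parts_le)
    have "int (h * a * opt_parts B r + d * r) - int a = int (x0 * a + h * a * n + d * M)"
      using x unfolding M_def n_def .
    then have eq: "h * a * opt_parts B r + d * r = a + x0 * a + h * a * n + d * M" by linarith
    have "[d * r = d * M] (mod a)"
    proof -
      have "(h * opt_parts B r) * a + d * r = (1 + x0 + h * n) * a + d * M"
        using eq by (simp add: algebra_simps)
      then have "((h * opt_parts B r) * a + d * r) mod a = ((1 + x0 + h * n) * a + d * M) mod a"
        by simp
      then show ?thesis unfolding cong_def by (simp only: mod_mult_self3)
    qed
    then have "[r = M] (mod a)"
      using \<open>coprime a d\<close> by (simp add: cong_mult_lcancel_nat coprime_commute)
    then have "M mod a = r" using \<open>r < a\<close> by (simp add: cong_def)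
    then have M: "M = M div a * a + r" using div_mult_mod_eq[of M a] by simp
    then have "r \<le> M" by linarith
    have "opt_parts B r \<le> n" using ge[OF \<open>r < a\<close>, of "M div a"] M n by simp
    then have "h * a * opt_parts B r + d * r \<le> h * a * n + d * M"
      using \<open>r \<le> M\<close> by (intro add_mono mult_left_mono) auto
    then show False using eq \<open>a > 0\<close> by linarith
  qed
next
  fix n
  assume nr: "\<not> representable (shifted_seq B h d a) n"
  show "n \<le> int (h * a * opt_parts B r + d * r) - int a"
  proof (rule ccontr)
    assume gt: "\<not> ?thesis"
    \<comment> \<open>\<open>u\<close> inverts \<open>d\<close> modulo \<open>a\<close>, so
      \<open>s\<close> below indexes the class of \<open>n\<close>.\<close>
    obtain u where u: "[int d * u = 1] (mod int a)"
      using \<open>coprime a d\<close> cong_solve_coprime_int[of "int d" "int a"]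
      by (auto simp: coprime_commute)
    define s where "s = nat ((u * n) mod int a)"
    have s: "s < a" "int s = (u * n) mod int a" using \<open>a > 0\<close> by (auto simp: s_def nat_less_iff)
    have "[int d * int s = int d * (u * n)] (mod int a)"
      unfolding s(2) by (intro cong_mult cong_refl) simp
    also have "[int d * (u * n) = n] (mod int a)"
      using cong_mult[OF u cong_refl[of n]] by (simp add: mult.assoc)
    finally have "[int d * int s = n] (mod int a)" .
    define N where "N = h * a * opt_parts B s + d * s"
    have "int N = int d * int s + int a * (int h * int (opt_parts B s))"
      by (simp add: N_def)
    then have "[int N = int d * int s] (mod int a)"
      by (simp add: cong_def)
    then have "[n = int N] (mod int a)"
      using \<open>[int d * int s = n] (mod int a)\<close> by (meson cong_sym cong_trans)
    then have "int a dvd n - int N" by (simp add: cong_iff_dvd_diff)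
    then obtain q where q: "n - int N = int a * q" by (auto elim: dvdE)
    have "int N \<le> int (h * a * opt_parts B r + d * r)" 
      using max[OF s(1)] by (simp only: N_def of_nat_le_iff)
    \<comment> \<open>\<open>n - N\<close> is a multiple of \<open>a\<close> exceeding
      \<open>-a\<close>, hence nonnegative, and adding \<open>q\<close> copies of \<open>a\<close>
      to \<open>N\<close> represents \<open>n\<close>.\<close>
    then have "int a * q > int a * (-1)" using gt q by linarith
    then have "q \<ge> 0" using \<open>a > 0\<close> by (subst (asm) mult_less_cancel_left_pos) auto
    obtain x :: "nat \<Rightarrow> nat" where
      "(\<Sum>i<length B. B ! i * x i) = s" "(\<Sum>i<length B. x i) = opt_parts B s"
      by (rule opt_parts_attained[OF assms(1,2)])
    moreover have "n = int (nat q * a + h * a * opt_parts B s + d * s)"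
      using q \<open>q \<ge> 0\<close> by (simp add: N_def algebra_simps)
    ultimately have "representable (shifted_seq B h d a) n"
      unfolding representable_shifted_seq by metis
    then show False using nr by simp
  qed
qed

theorem theorem4p3:
  fixes k c :: nat and B :: "nat list"
  assumes "k \<ge> 2" and "length B = k"
    and "hd B = 1" and "sorted_wrt (<) B"
    and "orderly B"
    and "c = Max (opt_parts B ` {0..last B - 1})" and "c \<ge> 2"
  shows "\<exists>w r :: nat \<Rightarrow> nat.
    (\<forall>h d :: nat. h > 0 \<longrightarrow> d > 0 \<longrightarrow> int h \<ge> \<lceil>real d / (real c - 1)\<rceil> \<longrightarrow>
      (\<forall>a :: nat. a > 0 \<longrightarrow> coprime a d \<longrightarrow> a \<ge> (c - 1) * last B \<longrightarrow>
        (\<forall>j<last B. [a = j] (mod last B) \<longrightarrow>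
          frobenius_number (shifted_seq B h d a) =
            (int (w j) * int h - 1) * int a + int (r j) * int d
            + (int h * int a + int (last B) * int d)
              * (\<lfloor>real a / real (last B)\<rfloor> - int c + 1)))) \<and>
    mono_on {0..last B - 1} w \<and> mono_on {0..last B - 1} r \<and>
    int (w (last B - 1)) - int (w 0) \<le> 1"
proof -
  define L where "L = last B"
  define f where "f = opt_parts B"
  have ne: "B \<noteq> []" using assms(1,2) by auto
  have "B ! 0 < B ! (k - 1)"
    using assms(1,2,4) by (auto simp: sorted_wrt_iff_nth_less)
  then have "L > 0" using ne assms(2) by (simp add: L_def last_conv_nth)
  have fdm: "f M = M div L + f (M mod L)" for M
    using greedy_parts_div_mod[OF ne] \<open>L > 0\<close> \<open>orderly B\<close>
    unfolding orderly_def f_def L_def by metis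
  have fL: "f (M + L) = Suc (f M)" for M
    using fdm[of M] fdm[of "M + L"] \<open>L > 0\<close> by simp
  have c: "c = Max (f ` {0..L - 1})" using assms(6) by (simp add: f_def L_def)
  have fc: "f t \<le> c" if "t < L" for t
    unfolding c using that by (intro Max_ge) auto
  have "c \<in> f ` {0..L - 1}" unfolding c by (intro Max_in) auto
  then obtain t0 where "t0 \<le> L - 1" and t0c: "f t0 = c" by auto
  then have t0: "t0 < L" "f t0 = c" using \<open>L > 0\<close> by linarith+
  have pos: "f t > 0" if "t > 0" for t
    using opt_parts_pos[OF ne assms(3) that] by (simp add: f_def)
  \<comment> \<open>The least admissible \<open>a\<close>, and a multiple of \<open>L\<close>, so
    \<open>N + j\<close> is the first admissible value in the class of \<open>j\<close>.\<close>
  define N where "N = (c - 1) * L"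
  have LN: "L \<le> N" using assms(7) unfolding N_def by (cases "c - 1") auto
  have "\<exists>r. lex_argmax f (N + j) r" for j
    using LN \<open>L > 0\<close> by (intro lex_argmax_exists) simp
  \<comment> \<open>Chosen from \<open>f\<close> and \<open>N\<close> before \<open>h\<close>,
    \<open>d\<close> and \<open>a\<close> appear, so both sequences depend on \<open>B\<close>
    alone.\<close>
  then obtain r where r: "\<And>j. lex_argmax f (N + j) (r j)" by metis
  define w where "w j = f (r j)" for j
  have frob: "frobenius_number (shifted_seq B h d a) =
            (int (w j) * int h - 1) * int a + int (r j) * int d
            + (int h * int a + int L * int d) * (\<lfloor>real a / real L\<rfloor> - int c + 1)"
    if h: "int h \<ge> \<lceil>real d / (real c - 1)\<rceil>" and a: "a > 0" "coprime a d" "a \<ge> (c - 1) * L"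
      and j: "j < L" "[a = j] (mod L)" for h d a j :: nat
  proof -
    have "c - 1 \<le> a div L" using a(3) \<open>L > 0\<close> by (simp add: less_eq_div_iff_mult_less_eq)
    \<comment> \<open>\<open>q\<close> counts the steps of length \<open>L\<close> from
      \<open>N + j\<close> to \<open>a\<close>; it is the floor factor of the formula.\<close>
    define q where "q = a div L - (c - 1)"
    have "a mod L = j" using j by (simp add: cong_def)
    then have "a = (c - 1 + q) * L + j"
      using \<open>c - 1 \<le> a div L\<close> div_mult_mod_eq[of a L] by (simp add: q_def)
    then have a_eq: "a = N + j + q * L" by (simp add: N_def algebra_simps)
    define R where "R = r j + q * L"
    have R: "lex_argmax f a R"
      unfolding R_def a_eq using fL fc t0 LN r by (intro lex_argmax_shift[where ?t0.0 = t0]) auto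
    have fR: "f (x + n * L) = f x + n" for x n
    proof (induction n)
      case (Suc n)
      have "x + Suc n * L = (x + n * L) + L" by simp
      then show ?case using fL[of "x + n * L"] Suc by (simp only: add_Suc_right)
    qed simp
    have "real d / (real c - 1) \<le> real h" using h by (simp add: ceiling_le_iff)
    then have "real d \<le> real h * (real c - 1)" using assms(7) by (simp add: divide_le_eq)
    also have "\<dots> = real (h * (c - 1))" using assms(7) by (simp add: of_nat_diff)
    finally have "d \<le> h * (c - 1)" by (simp only: of_nat_le_iff)
    then have "d * L \<le> h * (c - 1) * L" by simp
    also have "\<dots> \<le> h * a" using a(3) by (simp add: mult.assoc)
    finally have dL: "d * L \<le> h * a" .
    have "frobenius_number (shifted_seq B h d a) = int (h * a * f R + d * R) - int a"
      unfolding f_def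
    proof (rule frobenius_number_shifted_seq[OF ne assms(3) a(1,2)])
      show "opt_parts B s \<le> opt_parts B (m * a + s)" for m s
        using le_add_mult_of_div_mod[of f L c a s m] fdm \<open>L > 0\<close> fc pos a(3) unfolding f_def by blast
      show "R < a" using R by (simp add: lex_argmax_def)
      show "h * a * opt_parts B s + d * s \<le> h * a * opt_parts B R + d * R" if "s < a" for s
        using lex_argmax_weighted[of f L a R s d h] fL R that dL by (simp add: f_def)
    qed
    also have "f R = w j + q" unfolding R_def w_def by (rule fR)
    \<comment> \<open>The shift adds \<open>h * a * q\<close> through \<open>f R\<close> and
      \<open>d * L * q\<close> through \<open>R\<close>, which together form the last term.\<close>
    also have "int (h * a * (w j + q) + d * R) - int a =
      (int (w j) * int h - 1) * int a + int (r j) * int d + (int h * int a + int L * int d) * int q"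
      unfolding R_def by (simp add: algebra_simps)
    also have "int q = \<lfloor>real a / real L\<rfloor> - int c + 1"
      using \<open>c - 1 \<le> a div L\<close> assms(7) unfolding q_def
      by (simp add: floor_divide_of_nat_eq of_nat_diff)
    finally show ?thesis .
  qed
  have "mono_on {0..L - 1} w" "mono_on {0..L - 1} r"
    unfolding w_def using lex_argmax_mono[OF r r] by (auto intro!: mono_onI)
  \<comment> \<open>If the maximiser for \<open>N + L - 1\<close> lies below \<open>L\<close>, its
    value is at most \<open>c\<close>, which \<open>t0\<close> attains below \<open>N\<close>.
    Otherwise moving it down by \<open>L\<close> lands below \<open>N\<close> and costs one
    unit.\<close>
  moreover have "w (L - 1) \<le> w 0 + 1"
  proof (cases "r (L - 1) < L")
    case True
    have "f t0 \<le> w 0" using r[of 0] less_le_trans[OF t0(1) LN] by (simp add: w_def lex_argmax_def)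
    then show ?thesis using fc[OF True] t0 by (simp add: w_def)
  next
    case False
    then have "w (L - 1) = Suc (f (r (L - 1) - L))"
      using fL[of "r (L - 1) - L"] by (simp add: w_def)
    moreover have "r (L - 1) - L < N"
      using r[of "L - 1"] False by (auto simp: lex_argmax_def)
    then have "f (r (L - 1) - L) \<le> w 0"
      using r[of 0] by (simp add: w_def lex_argmax_def)
    ultimately show ?thesis by simp
  qed
  then have "int (w (L - 1)) - int (w 0) \<le> 1" by linarith
  ultimately show ?thesis
    unfolding L_def[symmetric]
    by (intro exI[of _ w] exI[of _ r] conjI allI impI) (rule frob)
qed

end
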